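(* Let $X$ and $Y$ be Banach spaces over $\mathbb{K}$ ($\mathbb{K}=\mathbb{R}$ or $\mathbb{C}$). Then the set $$\{T\in\mathcal{L}(X,Y^* ) : T\in w^*\mathrm{QNA}(X,Y^* ) \text{ and } T^\circ\in w^*\mathrm{QNA}(Y,X^* )\}$$ is norm dense in $\mathcal{L}(X,Y^* )$.
   Context: Banach spaces are over $\mathbb{K}=\mathbb{R}$ or $\mathbb{C}$. $B_X$ is the closed unit ball of $X$, $X^*$ its topological dual, and $\mathcal{L}(X,Y)$ the space of bounded linear operators from $X$ to $Y$ with the operator norm. An operator $T\in\mathcal{L}(X,Y^* )$ weak-star quasi attains its norm, written $T\in w^*\mathrm{QNA}(X,Y^* )$, if there exist a net $(x_\alpha)\subset B_X$ and $u^*\in Y^*$ with $\|u^*\|=\|T\|$ such that $Tx_\alpha\to u^*$ in $\sigma(Y^*,Y)$; equivalently, the $\sigma(Y^*,Y)$-closure of $T(B_X)$ intersects the sphere $\{u^*\in Y^*:\|u^*\|=\|T\|\}$. For $T\in\mathcal{L}(X,Y^* )$, its transposition $T^\circ\in\mathcal{L}(Y,X^* )$ is defined by $[T^\circ y](x)=[Tx](y)$ for all $y\in Y$, $x\in X$. *)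

theory Defs
  imports "HOL-Analysis.Analysis"
begin

text \<open>
  The scalar field is a type \<open>'k\<close>, to be instantiated with \<^typ>\<open>real\<close> and \<^typ>\<open>complex\<close>.
  A Banach space over \<open>'k\<close> is a type of class \<^class>\<open>banach\<close>, which supplies the norm and
  completeness, together with a scalar multiplication by \<open>'k\<close> that is homogeneous for the
  norm.  The last axiom only says that the real scaling built into the type is the
  restriction of \<open>scale\<close> to the real scalars; for \<open>'k = real\<close> it forces
  \<open>scale = scaleR\<close>.
\<close>

locale banach_over = vector_space scale
  for scale :: "'k::real_normed_field \<Rightarrow> 'a::banach \<Rightarrow> 'a" +
  assumes norm_scale: "norm (scale c x) = norm c * norm x"
    and scale_of_real: "scale (of_real r) x = r *\<^sub>R x"

lemma banach_over_scaleR: "banach_over (scaleR :: real \<Rightarrow> 'a::banach \<Rightarrow> 'a)"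
  by unfold_locales (auto simp: algebra_simps)

lemma banach_over_complex: "banach_over ((*) :: complex \<Rightarrow> complex \<Rightarrow> complex)"
  by unfold_locales (auto simp: algebra_simps norm_mult scaleR_conv_of_real)

text \<open>
  The dual over \<open>'k\<close> consists of the \<open>'k\<close>-linear elements of the type of bounded
  real-linear maps into \<open>'k\<close>; the norm of that type is the usual operator norm
  \<open>\<parallel>f\<parallel> = sup {\<parallel>f y\<parallel> / \<parallel>y\<parallel>}\<close>, so it restricts to the dual norm.
  The same applies to operators into the dual.
\<close>

definition dual_space ::
  "('k::real_normed_field \<Rightarrow> 'b::banach \<Rightarrow> 'b) \<Rightarrow> ('b \<Rightarrow>\<^sub>L 'k) set" where
  "dual_space sY = {f. \<forall>c y. blinfun_apply f (sY c y) = c * blinfun_apply f y}"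

definition operators_into_dual ::
  "('k::real_normed_field \<Rightarrow> 'a::banach \<Rightarrow> 'a) \<Rightarrow> ('k \<Rightarrow> 'b::banach \<Rightarrow> 'b) \<Rightarrow>
    ('a \<Rightarrow>\<^sub>L ('b \<Rightarrow>\<^sub>L 'k)) set" where
  "operators_into_dual sX sY =
    {T. (\<forall>x. blinfun_apply T x \<in> dual_space sY) \<and>
        (\<forall>c x y. blinfun_apply (blinfun_apply T (sX c x)) y
                  = c * blinfun_apply (blinfun_apply T x) y)}"

text \<open>
  The topology \<open>\<sigma>(Y\<^sup>*, Y)\<close>: the topology of pointwise convergence on \<open>Y\<close>
  (\<open>euclidean\<close> on a function type is the product topology).
\<close>

definition weak_star_topology ::
  "('k::real_normed_field \<Rightarrow> 'b::banach \<Rightarrow> 'b) \<Rightarrow> ('b \<Rightarrow>\<^sub>L 'k) topology" where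
  "weak_star_topology sY = pullback_topology (dual_space sY) blinfun_apply euclidean"

text \<open>
  A net \<open>(x\<^sub>\<alpha>)\<close> in the unit ball is given by the proper filter \<open>F\<close> on \<open>X\<close> of those sets
  that contain all its terms from some index on; conversely, every proper filter is the
  filter of some net.  The lemma \<open>wstar_QNA_iff_closure\<close> below gives the equivalent
  description by the weak-star closure of the image of the unit ball.
\<close>

definition wstar_QNA ::
  "('k::real_normed_field \<Rightarrow> 'a::banach \<Rightarrow> 'a) \<Rightarrow> ('k \<Rightarrow> 'b::banach \<Rightarrow> 'b) \<Rightarrow>
    ('a \<Rightarrow>\<^sub>L ('b \<Rightarrow>\<^sub>L 'k)) set" where
  "wstar_QNA sX sY =
    {T \<in> operators_into_dual sX sY.
      \<exists>(F :: 'a filter) u. F \<noteq> bot \<and> (\<forall>\<^sub>F x in F. x \<in> cball 0 1) \<and>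
        u \<in> dual_space sY \<and> norm u = norm T \<and>
        limitin (weak_star_topology sY) (blinfun_apply T) u F}"

definition transposition ::
  "('a::banach \<Rightarrow>\<^sub>L ('b::banach \<Rightarrow>\<^sub>L 'k::real_normed_field)) \<Rightarrow> 'b \<Rightarrow>\<^sub>L ('a \<Rightarrow>\<^sub>L 'k)" where
  "transposition T = Blinfun (\<lambda>y. Blinfun (\<lambda>x. blinfun_apply (blinfun_apply T x) y))"

lemma transposition_apply [simp]:
  "blinfun_apply (blinfun_apply (transposition T) y) x = blinfun_apply (blinfun_apply T x) y"
proof -
  have bl: "bounded_linear (\<lambda>x. blinfun_apply (blinfun_apply T x) y)" for y
    by (intro bounded_linear_intros)
  have app: "blinfun_apply (Blinfun (\<lambda>x. blinfun_apply (blinfun_apply T x) y)) x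
      = blinfun_apply (blinfun_apply T x) y" for x y
    by (simp add: bounded_linear_Blinfun_apply[OF bl])
  have "bounded_linear (\<lambda>y. Blinfun (\<lambda>x. blinfun_apply (blinfun_apply T x) y))"
  proof (rule bounded_linear_intro[where K = "norm T"])
    fix y
    show "norm (Blinfun (\<lambda>x. blinfun_apply (blinfun_apply T x) y)) \<le> norm y * norm T"
    proof (rule norm_blinfun_bound)
      fix x
      have "norm (blinfun_apply (blinfun_apply T x) y) \<le> norm (blinfun_apply T x) * norm y"
        by (rule norm_blinfun)
      also have "\<dots> \<le> norm T * norm x * norm y"
        by (intro mult_right_mono norm_blinfun) auto
      finally show "norm (blinfun_apply (Blinfun (\<lambda>x. blinfun_apply (blinfun_apply T x) y)) x)
          \<le> norm y * norm T * norm x"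
        by (simp add: app mult_ac)
    qed auto
  next
    fix y1 y2
    show "Blinfun (\<lambda>x. blinfun_apply (blinfun_apply T x) (y1 + y2)) =
        Blinfun (\<lambda>x. blinfun_apply (blinfun_apply T x) y1) +
        Blinfun (\<lambda>x. blinfun_apply (blinfun_apply T x) y2)"
      by (rule blinfun_eqI) (simp only: app blinfun.add_left, simp only: blinfun.add_right)
  next
    fix r y
    show "Blinfun (\<lambda>x. blinfun_apply (blinfun_apply T x) (r *\<^sub>R y)) =
        r *\<^sub>R Blinfun (\<lambda>x. blinfun_apply (blinfun_apply T x) y)"
      by (rule blinfun_eqI) (simp only: app blinfun.scaleR_left, simp only: blinfun.scaleR_right)
  qed
  then show ?thesis
    by (simp add: transposition_def bounded_linear_Blinfun_apply app)
qed

lemma transposition_in_operators: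
  "T \<in> operators_into_dual sX sY \<Longrightarrow> transposition T \<in> operators_into_dual sY sX"
  by (auto simp: operators_into_dual_def dual_space_def)

lemma limitin_weak_star_iff:
  "limitin (weak_star_topology sY) f u F \<longleftrightarrow>
    u \<in> dual_space sY \<and> (\<forall>\<^sub>F x in F. f x \<in> dual_space sY) \<and>
    (\<forall>y. ((\<lambda>x. blinfun_apply (f x) y) \<longlongrightarrow> blinfun_apply u y) F)"
  (is "?L \<longleftrightarrow> ?R")
proof
  assume L: ?L
  have u: "u \<in> dual_space sY"
    using L by (auto simp: limitin_def weak_star_topology_def topspace_pullback_topology)
  have ev: "\<forall>\<^sub>F x in F. f x \<in> blinfun_apply -` U \<inter> dual_space sY"
    if "open U" "blinfun_apply u \<in> U" for U
  proof -
    have "openin (weak_star_topology sY) (blinfun_apply -` U \<inter> dual_space sY)"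
      using that(1) by (auto simp: weak_star_topology_def openin_pullback_topology)
    moreover have "u \<in> blinfun_apply -` U \<inter> dual_space sY"
      using that(2) u by simp
    ultimately show ?thesis
      using L unfolding limitin_def by blast
  qed
  have "((\<lambda>x. blinfun_apply (f x) y) \<longlongrightarrow> blinfun_apply u y) F" for y
  proof (rule topological_tendstoI)
    fix S assume S: "open S" "blinfun_apply u y \<in> S"
    have "open ((\<lambda>g. g y) -` S :: ('a \<Rightarrow> 'b) set)"
      by (intro open_vimage S continuous_on_product_coordinates)
    from ev[OF this] S show "\<forall>\<^sub>F x in F. blinfun_apply (f x) y \<in> S"
      by (auto elim: eventually_mono)
  qed
  moreover have "\<forall>\<^sub>F x in F. f x \<in> dual_space sY"
    using ev[of UNIV] by auto
  ultimately show ?R using u by blast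
next
  assume R: ?R
  have "limitin (product_topology (\<lambda>_. euclidean) UNIV) (\<lambda>x. blinfun_apply (f x)) (blinfun_apply u) F"
    using R unfolding limitin_componentwise by simp
  then have lim: "((\<lambda>x. blinfun_apply (f x)) \<longlongrightarrow> blinfun_apply u) F"
    unfolding euclidean_product_topology limitin_canonical_iff .
  show ?L
    unfolding limitin_def
  proof (intro conjI allI impI)
    show "u \<in> topspace (weak_star_topology sY)"
      using R by (simp add: weak_star_topology_def topspace_pullback_topology)
    fix V assume "openin (weak_star_topology sY) V \<and> u \<in> V"
    then obtain U where U: "open U" "V = blinfun_apply -` U \<inter> dual_space sY" "u \<in> V"
      by (auto simp: weak_star_topology_def openin_pullback_topology)
    have "\<forall>\<^sub>F x in F. blinfun_apply (f x) \<in> U"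
      using U by (intro topological_tendstoD[OF lim]) auto
    moreover have "\<forall>\<^sub>F x in F. f x \<in> dual_space sY"
      using R by blast
    ultimately show "\<forall>\<^sub>F x in F. f x \<in> V"
      by eventually_elim (simp add: U(2))
  qed
qed

lemma wstar_QNA_iff_closure:
  assumes T: "T \<in> operators_into_dual sX sY"
  shows "T \<in> wstar_QNA sX sY \<longleftrightarrow>
    (weak_star_topology sY closure_of (blinfun_apply T ` cball 0 1)) \<inter>
      {u \<in> dual_space sY. norm u = norm T} \<noteq> {}"
  (is "_ \<longleftrightarrow> ?W closure_of ?S \<inter> ?N \<noteq> {}")
proof
  assume "T \<in> wstar_QNA sX sY"
  then obtain F u where F: "F \<noteq> bot" "\<forall>\<^sub>F x in F. x \<in> cball 0 1"
    and u: "u \<in> ?N" and lim: "limitin ?W (blinfun_apply T) u F"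
    by (auto simp: wstar_QNA_def)
  have "\<exists>v\<in>?S. v \<in> U" if "u \<in> U" "openin ?W U" for U
  proof -
    have "\<forall>\<^sub>F x in F. blinfun_apply T x \<in> U"
      using lim that by (auto simp: limitin_def)
    with F(2) have "\<forall>\<^sub>F x in F. x \<in> cball 0 1 \<and> blinfun_apply T x \<in> U"
      by eventually_elim simp
    from eventually_happens'[OF F(1) this] show ?thesis by blast
  qed
  moreover have "u \<in> topspace ?W"
    using lim by (simp add: limitin_def)
  ultimately have "u \<in> ?W closure_of ?S"
    by (simp add: in_closure_of)
  with u show "?W closure_of ?S \<inter> ?N \<noteq> {}" by blast
next
  assume "?W closure_of ?S \<inter> ?N \<noteq> {}"
  then obtain u where cl: "u \<in> ?W closure_of ?S" and u: "u \<in> ?N" by blast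
  define G where "G = {U. openin ?W U \<and> u \<in> U}"
  define F where "F = (INF U\<in>G. principal (cball 0 1 \<inter> blinfun_apply T -` U))"
  have top: "u \<in> topspace ?W" using cl by (simp add: in_closure_of)
  then have "topspace ?W \<in> G" by (simp add: G_def)
  then have ne: "G \<noteq> {}" by blast
  have ev: "eventually P F \<longleftrightarrow>
      (\<exists>U\<in>G. eventually P (principal (cball 0 1 \<inter> blinfun_apply T -` U)))" for P
    unfolding F_def
  proof (rule eventually_INF_base[OF ne])
    fix U V assume "U \<in> G" "V \<in> G"
    then show "\<exists>W\<in>G. principal (cball 0 1 \<inter> blinfun_apply T -` W)
        \<le> inf (principal (cball 0 1 \<inter> blinfun_apply T -` U))
              (principal (cball 0 1 \<inter> blinfun_apply T -` V))"
      by (intro bexI[of _ "U \<inter> V"]) (auto simp: G_def)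
  qed
  have "\<exists>x. x \<in> cball 0 1 \<inter> blinfun_apply T -` U" if "U \<in> G" for U
  proof -
    have "\<exists>v\<in>?S. v \<in> U"
      using cl that by (simp add: G_def in_closure_of)
    then show ?thesis by blast
  qed
  then have F: "F \<noteq> bot"
    unfolding trivial_limit_def ev eventually_principal by blast
  have ball: "\<forall>\<^sub>F x in F. x \<in> cball 0 1"
    unfolding ev eventually_principal using ne by blast
  have lim: "limitin ?W (blinfun_apply T) u F"
    unfolding limitin_def
  proof (intro conjI allI impI top)
    fix U assume "openin ?W U \<and> u \<in> U"
    then have "U \<in> G" by (simp add: G_def)
    then show "\<forall>\<^sub>F x in F. blinfun_apply T x \<in> U"
      unfolding ev eventually_principal by blast
  qed
  show "T \<in> wstar_QNA sX sY"
    unfolding wstar_QNA_def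
  proof (intro CollectI conjI exI)
    show "u \<in> dual_space sY" "norm u = norm T" using u by auto
  qed (fact T F ball lim)+
qed

end

theory Submission
  imports Defs
begin

text \<open>
  The argument is Lindenstrauss' perturbation scheme.  Starting with \<open>T\<^sub>0 = T\<close>, pick
  \<open>(x\<^sub>n, y\<^sub>n)\<close> in the unit balls almost norming the bilinear form \<open>T\<^sub>n\<close> and add to \<open>T\<^sub>n\<close> a small
  multiple of the rank-one form \<open>(x, y) \<mapsto> T\<^sub>n x y\<^sub>n \<cdot> T\<^sub>n x\<^sub>n y\<close>, with coefficients decreasing faster than
  geometrically.  Since a later pair \<open>(x\<^sub>m, y\<^sub>m)\<close> almost norms \<open>T\<^bsub>n+1\<^esub>\<close> as well, both factors
  \<open>T\<^sub>n x\<^sub>m y\<^sub>n\<close> and \<open>T\<^sub>n x\<^sub>n y\<^sub>m\<close> must be nearly as large as \<open>\<parallel>T\<^sub>n\<parallel>\<close>.  Hence the limit \<open>S\<close> satisfies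
  \<open>\<bar>S x\<^sub>m y\<^sub>n\<bar>, \<bar>S x\<^sub>n y\<^sub>m\<bar> \<ge> \<parallel>S\<parallel> - \<eta>\<^sub>n\<close> for all \<open>m > n\<close> with \<open>\<eta>\<^sub>n \<longrightarrow> 0\<close>, and by compactness the weak-star
  cluster points of \<open>S x\<^sub>m\<close> and of \<open>S\<degree> y\<^sub>m\<close> have norm \<open>\<parallel>S\<parallel>\<close>.
\<close>

section \<open>Compactness along filters and norms of bilinear forms\<close>

text \<open>The filter version of passing to a convergent subnet. Sets of \<open>F\<close> meet the
  preimages of the neighbourhoods of a cluster point, so adjoining these preimages to
  \<open>F\<close> keeps the filter proper and makes \<open>f\<close> converge.\<close>

lemma compact_cluster_filter:
  fixes f :: "'a \<Rightarrow> 'b::topological_space"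
  assumes "compact K" "F \<noteq> bot" "\<forall>\<^sub>F x in F. f x \<in> K"
  obtains G u where "G \<noteq> bot" "G \<le> F" "u \<in> K" "(f \<longlongrightarrow> u) G"
proof -
  have "filtermap f F \<noteq> bot"
    using assms(2) by (simp add: filtermap_bot_iff)
  moreover have "\<forall>\<^sub>F z in filtermap f F. z \<in> K"
    using assms(3) by (simp add: eventually_filtermap)
  ultimately obtain u where u: "u \<in> K" "inf (nhds u) (filtermap f F) \<noteq> bot"
    using assms(1) unfolding compact_filter by blast
  define G where "G = inf F (filtercomap f (nhds u))"
  have "G \<noteq> bot"
  proof
    assume "G = bot"
    then obtain P Q where "eventually P F" "eventually Q (nhds u)" "\<And>x. P x \<Longrightarrow> Q (f x) \<Longrightarrow> False"
      unfolding G_def trivial_limit_def eventually_inf eventually_filtercomap by metis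
    from this(1) have "\<forall>\<^sub>F x in F. \<not> Q (f x)"
      by (rule eventually_mono) (use \<open>\<And>x. P x \<Longrightarrow> Q (f x) \<Longrightarrow> False\<close> in blast)
    then have "\<forall>\<^sub>F z in filtermap f F. \<not> Q z"
      by (simp add: eventually_filtermap)
    with \<open>eventually Q (nhds u)\<close> have "inf (nhds u) (filtermap f F) = bot"
      unfolding trivial_limit_def eventually_inf by blast
    with u show False by simp
  qed
  moreover have "(f \<longlongrightarrow> u) G"
    unfolding filterlim_def G_def
    by (metis filtermap_mono inf.cobounded2 filtermap_filtercomap order_trans)
  ultimately show ?thesis
    using that u(1) by (auto simp: G_def)
qed

lemma compact_Pi_UNIV:
  fixes S :: "'a \<Rightarrow> 'b::topological_space set"
  assumes "\<And>i. compact (S i)"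
  shows "compact (Pi UNIV S)"
proof -
  have "compactin (product_topology (\<lambda>_. euclidean) UNIV) (PiE UNIV S)"
    unfolding compactin_PiE using assms by simp
  then show ?thesis
    by (simp add: euclidean_product_topology PiE_UNIV_domain)
qed

lemma blinfun_almost_norming:
  fixes f :: "'a::real_normed_vector \<Rightarrow>\<^sub>L 'b::real_normed_vector"
  assumes "0 < d"
  obtains x where "norm x \<le> 1" "norm f - d < norm (f x)"
proof (rule ccontr)
  assume "\<not> thesis"
  with that have le: "norm (f x) \<le> norm f - d" if "norm x \<le> 1" for x
    using \<open>norm x \<le> 1\<close> by force
  have "norm f \<le> norm f - d"
  proof (rule norm_blinfun_bound)
    show "0 \<le> norm f - d"
      using le[of 0] by simp
    fix x
    have "norm (f (x /\<^sub>R norm x)) \<le> norm f - d"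
      by (rule le) (cases "x = 0"; simp)
    then show "norm (f x) \<le> (norm f - d) * norm x"
      by (cases "x = 0") (simp_all add: blinfun.scaleR_right field_simps)
  qed
  with assms show False by simp
qed

lemma norm_blinfun2:
  fixes T :: "'a::real_normed_vector \<Rightarrow>\<^sub>L ('b::real_normed_vector \<Rightarrow>\<^sub>L 'c::real_normed_vector)"
  shows "norm (T x y) \<le> norm T * norm x * norm y"
  by (meson norm_blinfun mult_right_mono norm_ge_zero order_trans)

lemma norm_blinfun2_ball:
  fixes T :: "'a::real_normed_vector \<Rightarrow>\<^sub>L ('b::real_normed_vector \<Rightarrow>\<^sub>L 'c::real_normed_vector)"
  assumes "norm x \<le> 1" "norm y \<le> 1"
  shows "norm (T x y) \<le> norm T"
proof -
  have "norm T * norm x * norm y \<le> norm T * 1 * 1"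
    using assms by (intro mult_mono) auto
  with norm_blinfun2[of T x y] show ?thesis by simp
qed

lemma norm_blinfun2_bound:
  fixes T :: "'a::real_normed_vector \<Rightarrow>\<^sub>L ('b::real_normed_vector \<Rightarrow>\<^sub>L 'c::real_normed_vector)"
  assumes "0 \<le> b" "\<And>x y. norm (T x y) \<le> b * norm x * norm y"
  shows "norm T \<le> b"
  by (intro norm_blinfun_bound assms mult_nonneg_nonneg norm_ge_zero)

lemma transposition_transposition [simp]: "transposition (transposition T) = T"
  by (intro blinfun_eqI) simp

lemma norm_transposition [simp]: "norm (transposition T) = norm T"
proof -
  have "norm (transposition S) \<le> norm S"
    for S :: "'x::banach \<Rightarrow>\<^sub>L ('y::banach \<Rightarrow>\<^sub>L 'z::real_normed_field)"
    by (rule norm_blinfun2_bound) (use norm_blinfun2[of S] in \<open>auto simp: mult_ac\<close>)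
  from this[of T] this[of "transposition T"] show ?thesis by simp
qed

section \<open>Weak-star cluster points of full norm\<close>

text \<open>This is the Banach-Alaoglu argument: the functions \<open>T (x m)\<close> lie in a
  product of scalar balls, compact by Tychonoff, so they converge pointwise along a filter finer
  than \<open>sequentially\<close>. The limit is a functional of norm at most \<open>norm T\<close>,
  and its values at the \<open>y n\<close> force equality.\<close>

lemma wstar_QNA_if_double_sequence:
  fixes T :: "'a::banach \<Rightarrow>\<^sub>L ('b::banach \<Rightarrow>\<^sub>L 'k::{real_normed_field,heine_borel})"
  assumes T: "T \<in> operators_into_dual sX sY"
    and x: "\<And>n. norm (x n) \<le> 1" and y: "\<And>n. norm (y n) \<le> 1"
    and le: "\<And>n m. n < m \<Longrightarrow> norm T - \<eta> n \<le> norm (T (x m) (y n))"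
    and \<eta>: "\<eta> \<longlonglongrightarrow> 0"
  shows "T \<in> wstar_QNA sX sY"
proof -
  define K where "K = Pi UNIV (\<lambda>y::'b. cball (0::'k) (norm T * norm y))"
  have in_K: "blinfun_apply (T (x m)) \<in> K" for m
  proof -
    have "norm (T (x m) z) \<le> norm T * norm z" for z
    proof -
      have "norm T * norm (x m) * norm z \<le> norm T * 1 * norm z"
        using x by (intro mult_right_mono mult_left_mono) auto
      with norm_blinfun2[of T "x m" z] show ?thesis by simp
    qed
    then show ?thesis by (simp add: K_def)
  qed
  have "compact K"
    unfolding K_def by (rule compact_Pi_UNIV) simp
  then obtain G u where G: "G \<noteq> bot" "G \<le> sequentially" and u: "u \<in> K"
    and lim: "((\<lambda>m. blinfun_apply (T (x m))) \<longlongrightarrow> u) G"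
    using in_K
    by (rule compact_cluster_filter[OF _ sequentially_bot always_eventually[OF allI]])
  have lim: "((\<lambda>m. T (x m) z) \<longlongrightarrow> u z) G" for z
    by (rule continuous_on_tendsto_compose[OF continuous_on_product_coordinates[of z] lim]) auto
  \<comment> \<open>Linearity passes to the limit: \<open>u z\<close> is the only limit of
    \<open>T (x m) z\<close> along \<open>G\<close>, so each identity satisfied by all
    \<open>T (x m)\<close> holds for \<open>u\<close>.\<close>
  note uniq = tendsto_unique[OF G(1) lim]
  have "bounded_linear u"
  proof (rule bounded_linear_intro)
    show "u (v + w) = u v + u w" for v w
      by (rule uniq) (simp add: blinfun.add_right tendsto_add lim)
    show "u (r *\<^sub>R v) = r *\<^sub>R u v" for r v
      by (rule uniq) (simp add: blinfun.scaleR_right tendsto_scaleR lim)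
    show "norm (u v) \<le> norm v * norm T" for v
      using u by (simp add: K_def Pi_iff mult.commute)
  qed
  then obtain v where v: "u = blinfun_apply v"
    by (metis bounded_linear_Blinfun_apply)
  have "v \<in> dual_space sY"
    unfolding dual_space_def
  proof (intro CollectI allI)
    show "v (sY c z) = c * v z" for c z
      unfolding v[symmetric] using T
      by (intro uniq) (simp add: operators_into_dual_def dual_space_def tendsto_mult lim)
  qed
  have "norm v \<le> norm T"
    using u by (intro norm_blinfun_bound) (auto simp: K_def v)
  \<comment> \<open>Here \<open>n\<close> is fixed and only \<open>m\<close> runs along
    \<open>G\<close>, where eventually \<open>n < m\<close>; the limit in \<open>n\<close> is taken
    afterwards.\<close>
  moreover have "norm T - \<eta> n \<le> norm v" for n
  proof -
    have "\<forall>\<^sub>F m in G. norm T - \<eta> n \<le> norm (T (x m) (y n))"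
      using eventually_gt_at_top[of n] G(2) le by (blast intro: filter_leD eventually_mono)
    with tendsto_norm[OF lim[of "y n"]] have "norm T - \<eta> n \<le> norm (u (y n))"
      by (intro tendsto_lowerbound) (use G in auto)
    also have "\<dots> \<le> norm v * norm (y n)"
      unfolding v by (rule norm_blinfun)
    also have "\<dots> \<le> norm v * 1"
      using y by (intro mult_left_mono) auto
    finally show ?thesis by simp
  qed
  then have "norm T - 0 \<le> norm v"
    by (intro LIMSEQ_le_const2[OF tendsto_diff[OF tendsto_const \<eta>]]) auto
  ultimately have "norm v = norm T" by simp
  \<comment> \<open>The filter \<open>G\<close> lives on indices; its image under \<open>x\<close>
    is the required filter on the space.\<close>
  have "limitin (weak_star_topology sY) (blinfun_apply T) v (filtermap x G)"
    unfolding limitin_weak_star_iff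
    using T \<open>v \<in> dual_space sY\<close> lim
    by (auto simp: operators_into_dual_def filterlim_filtermap v)
  moreover have "filtermap x G \<noteq> bot"
    using G by (simp add: filtermap_bot_iff)
  ultimately show ?thesis
    using T \<open>v \<in> dual_space sY\<close> \<open>norm v = norm T\<close> x
    unfolding wstar_QNA_def by (auto simp: eventually_filtermap intro!: exI[of _ "filtermap x G"] exI[of _ v])
qed

section \<open>Rank-one perturbations\<close>

definition rank_one ::
  "('a::real_normed_vector \<Rightarrow>\<^sub>L 'k) \<Rightarrow> ('b::real_normed_vector \<Rightarrow>\<^sub>L 'k) \<Rightarrow>
    'a \<Rightarrow>\<^sub>L ('b \<Rightarrow>\<^sub>L 'k::real_normed_algebra)" where
  "rank_one f g = Blinfun (\<lambda>x. blinfun_mult_right (f x) o\<^sub>L g)"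

lemma rank_one_apply [simp]: "rank_one f g x y = f x * g y"
proof -
  have "bounded_linear (\<lambda>x. blinfun_mult_right (f x) o\<^sub>L g)"
    by (intro bounded_linear_intros)
  then show ?thesis
    by (simp add: rank_one_def bounded_linear_Blinfun_apply)
qed

lemma norm_rank_one: "norm (rank_one f g) \<le> norm f * norm g"
proof (rule norm_blinfun2_bound)
  fix x y
  have "norm (f x * g y) \<le> norm (f x) * norm (g y)"
    by (rule norm_mult_ineq)
  also have "\<dots> \<le> (norm f * norm x) * (norm g * norm y)"
    by (intro mult_mono norm_blinfun) auto
  finally show "norm (rank_one f g x y) \<le> norm f * norm g * norm x * norm y"
    by (simp add: mult_ac)
qed simp

text \<open>Ensures that the norm limit of the perturbed operators is still linear over the scalars
  in both variables.\<close>

lemma closed_operators_into_dual: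
  "closed (operators_into_dual (sX :: 'k::real_normed_field \<Rightarrow> 'a::banach \<Rightarrow> 'a)
    (sY :: 'k \<Rightarrow> 'b::banach \<Rightarrow> 'b))"
proof -
  have "operators_into_dual sX sY =
      (\<Inter>x y c. {T. blinfun_apply (blinfun_apply T x) (sY c y) = c * T x y}) \<inter> (\<Inter>x y c. {T. blinfun_apply (blinfun_apply T (sX c x)) y = c * T x y})"
    by (auto simp: operators_into_dual_def dual_space_def)
  then show ?thesis
    by (auto intro!: closed_Int closed_INT closed_Collect_eq continuous_intros)
qed

text \<open>The form added at \<open>(x', y')\<close> has size at most
  \<open>e / (norm T)\<^sup>2\<close> times the product of \<open>norm (T x' y)\<close> and
  \<open>norm (T x y')\<close>; bounding either factor by \<open>norm T\<close> gives the last two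
  inequalities. As \<open>norm T'\<close> is nearly \<open>norm T + e\<close>, a pair almost norming
  \<open>T'\<close> must make both factors nearly \<open>norm T\<close>.\<close>

lemma rank_one_perturbation:
  fixes T :: "'a::banach \<Rightarrow>\<^sub>L ('b::banach \<Rightarrow>\<^sub>L 'k::real_normed_field)"
  assumes T: "T \<in> operators_into_dual sX sY" and T0: "T \<noteq> 0" and e: "0 < e" and d: "0 < d"
  shows "\<exists>T' x y. T' \<in> operators_into_dual sX sY \<and> norm x \<le> 1 \<and> norm y \<le> 1 \<and>
    norm T - d \<le> norm (T x y) \<and> norm (T' - T) \<le> e \<and> norm T + e - d \<le> norm T' \<and>
    (\<forall>x' y'. norm x' \<le> 1 \<longrightarrow> norm y' \<le> 1 \<longrightarrow>
      norm (T' x' y') \<le> norm T + e * (norm (T x' y) / norm T) \<and>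
      norm (T' x' y') \<le> norm T + e * (norm (T x y') / norm T))"
proof -
  define N where "N = norm T"
  have N: "0 < N" using T0 by (simp add: N_def)
  \<comment> \<open>With \<open>s\<close> at least \<open>N - d'\<close>, the value
    \<open>s + (e / N\<^sup>2) * s\<^sup>2\<close> reached at \<open>(x, y)\<close> misses
    \<open>N + e\<close> by at most \<open>d' + 2 * e / N * d'\<close>, which this choice makes
    equal to \<open>d\<close>.\<close>
  define d' where "d' = d / (1 + 2 * e / N)"
  have pos: "0 < 1 + 2 * e / N" using e N by (simp add: add_pos_pos)
  have d': "0 < d'" "d' * (1 + 2 * e / N) = d"
    using d pos by (simp_all add: d'_def)
  obtain x where x: "norm x \<le> 1" "norm T - d' / 2 < norm (T x)"
    using blinfun_almost_norming[of "d' / 2" T] d' by auto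
  obtain y where y: "norm y \<le> 1" "norm (T x) - d' / 2 < norm (T x y)"
    using blinfun_almost_norming[of "d' / 2" "T x"] d' by auto
  define b where "b = T x y"
  define s where "s = norm b"
  have s: "N - d' \<le> s" "0 \<le> s" using x y by (auto simp: s_def b_def N_def)
  define c where "c = of_real s / b"
  \<comment> \<open>also for \<open>b = 0\<close>, where \<open>c = 0\<close>\<close>
  have c: "norm c \<le> 1" "c * b = of_real s"
    by (cases "b = 0"; simp add: c_def s_def norm_divide)+
  \<comment> \<open>The factor \<open>c\<close> corrects the phase: \<open>R x y = s * b\<close> is
    a nonnegative multiple of \<open>T x y\<close>, so the two absolute values add up at
    \<open>(x, y)\<close>.\<close>
  define R where "R = rank_one (blinfun_mult_right c o\<^sub>L transposition T y) (T x)"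
  have R: "R x' y' = c * T x' y * T x y'" for x' y'
    by (simp add: R_def)
  define T' where "T' = T + (e / N\<^sup>2) *\<^sub>R R"
  have T': "T' x' y' = T x' y' + (e / N\<^sup>2) *\<^sub>R R x' y'" for x' y'
    by (simp add: T'_def blinfun.add_left blinfun.scaleR_left)
  have "T' \<in> operators_into_dual sX sY"
    using T unfolding operators_into_dual_def dual_space_def
    by (auto simp: T' R algebra_simps scaleR_conv_of_real)
  \<comment> \<open>Here \<open>p\<close> is either of the two factors in \<open>R x' y'\<close>;
    the other one is at most \<open>N\<close> on the unit balls.\<close>
  moreover have up: "norm (T' x' y') \<le> N + e * (p / N)"
    if "norm x' \<le> 1" "norm y' \<le> 1"
      and p: "p = norm (T x' y) \<or> p = norm (T x y')" for x' y' p
  proof -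
    have "norm (R x' y') \<le> 1 * (norm (T x' y) * norm (T x y'))"
      unfolding R norm_mult mult.assoc using c(1) by (intro mult_right_mono) auto
    also have "\<dots> \<le> N * p"
      using p
    proof
      assume "p = norm (T x' y)"
      then show ?thesis
        using mult_left_mono[OF norm_blinfun2_ball[OF x(1) that(2), of T], of p]
        by (simp add: N_def mult.commute)
    next
      assume "p = norm (T x y')"
      then show ?thesis
        using mult_right_mono[OF norm_blinfun2_ball[OF that(1) y(1), of T], of p]
        by (simp add: N_def)
    qed
    finally have "(e / N\<^sup>2) * norm (R x' y') \<le> (e / N\<^sup>2) * (N * p)"
      using e by (intro mult_left_mono) auto
    also have "\<dots> = e * (p / N)"
      using N by (simp add: power2_eq_square)
    finally have "norm ((e / N\<^sup>2) *\<^sub>R R x' y') \<le> e * (p / N)"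
      using e by simp
    with norm_blinfun2_ball[OF that(1,2), of T] show ?thesis
      unfolding T' N_def by (intro norm_triangle_le add_mono)
  qed
  moreover have "norm (T' - T) \<le> e"
  proof -
    have "norm R \<le> norm (blinfun_mult_right c o\<^sub>L transposition T y) * norm (T x)"
      unfolding R_def by (rule norm_rank_one)
    also have "\<dots> \<le> N * N"
    proof (rule mult_mono)
      show "norm (T x) \<le> N"
        using order_trans[OF norm_blinfun[of T x] mult_left_mono[OF x(1), of "norm T"]]
        by (simp add: N_def)
      show "norm (blinfun_mult_right c o\<^sub>L transposition T y) \<le> N"
      proof (rule norm_blinfun_bound)
        fix z
        have "norm (c * T z y) \<le> 1 * (N * norm z * norm y)"
          unfolding norm_mult N_def by (intro mult_mono c norm_blinfun2) auto
        also have "\<dots> \<le> N * norm z * 1"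
          using y N by (simp add: mult_left_le)
        finally show "norm ((blinfun_mult_right c o\<^sub>L transposition T y) z) \<le> N * norm z"
          by simp
      qed (use N in simp)
    qed (use N in auto)
    finally have "(e / N\<^sup>2) * norm R \<le> (e / N\<^sup>2) * (N * N)"
      using e by (intro mult_left_mono) auto
    also have "\<dots> = e" using N by (simp add: power2_eq_square)
    finally show ?thesis using e by (simp add: T'_def)
  qed
  moreover have "N + e - d \<le> norm T'"
  proof -
    \<comment> \<open>Squaring \<open>N - d' \<le> s\<close> needs a nonnegative left side; for
      \<open>d' > N\<close> the claimed lower bound is itself nonpositive.\<close>
    have "N\<^sup>2 - 2 * N * d' \<le> s\<^sup>2"
    proof (cases "d' \<le> N")
      case True
      then have "(N - d')\<^sup>2 \<le> s\<^sup>2" using s by (intro power_mono) auto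
      then show ?thesis using zero_le_power2[of d'] unfolding power2_diff by linarith
    next
      case False
      then have "N * N \<le> N * d'" using N by (intro mult_left_mono) auto
      moreover have "0 \<le> N * d'" using N d' by simp
      ultimately have "N\<^sup>2 - 2 * N * d' \<le> 0" unfolding power2_eq_square by linarith
      then show ?thesis by (smt (verit) zero_le_power2)
    qed
    then have "(e / N\<^sup>2) * (N\<^sup>2 - 2 * N * d') \<le> (e / N\<^sup>2) * s\<^sup>2"
      using e by (intro mult_left_mono) auto
    moreover have "(e / N\<^sup>2) * (N\<^sup>2 - 2 * N * d') = e - 2 * e / N * d'"
      using N by (simp add: power2_eq_square field_simps)
    moreover have "d' + 2 * e / N * d' = d"
      using d'(2) by (simp add: algebra_simps)
    ultimately have "N + e - d \<le> s + (e / N\<^sup>2) * s\<^sup>2"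
      using s by linarith
    also have "\<dots> = norm (T' x y)"
    proof -
      have "R x y = of_real s * b"
        using c(2) unfolding R b_def by simp
      then have "T' x y = of_real (1 + (e / N\<^sup>2) * s) * b"
        unfolding T' b_def[symmetric] by (simp add: scaleR_conv_of_real algebra_simps)
      then have "norm (T' x y) = \<bar>1 + (e / N\<^sup>2) * s\<bar> * s"
        by (simp only: norm_mult norm_of_real s_def)
      also have "\<bar>1 + (e / N\<^sup>2) * s\<bar> = 1 + (e / N\<^sup>2) * s"
        using e s by (intro abs_of_nonneg) auto
      finally show ?thesis by (simp add: algebra_simps power2_eq_square)
    qed
    also have "\<dots> \<le> norm T'"
      by (rule norm_blinfun2_ball[OF x(1) y(1)])
    finally show ?thesis .
  qed
  moreover have "N - d \<le> norm (T x y)"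
  proof -
    have "d' * 1 \<le> d' * (1 + 2 * e / N)"
      using d' e N by (intro mult_left_mono) auto
    with s d' show ?thesis by (simp add: s_def b_def)
  qed
  ultimately show ?thesis
    using x(1) y(1) unfolding N_def by blast
qed

section \<open>Iteration of the perturbation and its limit\<close>

lemma norm_attaining_approximation:
  fixes T :: "'a::banach \<Rightarrow>\<^sub>L ('b::banach \<Rightarrow>\<^sub>L 'k::{real_normed_field,banach,heine_borel})"
  assumes T: "T \<in> operators_into_dual sX sY" and T0: "T \<noteq> 0" and e: "0 < e"
  shows "\<exists>S \<in> operators_into_dual sX sY. norm (S - T) \<le> e \<and>
    S \<in> wstar_QNA sX sY \<and> transposition S \<in> wstar_QNA sY sX"
proof -
  define r :: "nat \<Rightarrow> real" where "r n = e / fact (Suc n)" for n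
  \<comment> \<open>\<open>d n\<close> is the size of the \<open>n\<close>-th perturbation; the tail sum \<open>r (Suc n)\<close> of the later ones is
    negligible against it, by a factor of \<open>Suc n\<close>.\<close>
  define d where "d n = r n - r (Suc n)" for n
  have rpos: "0 < r n" for n using e by (simp add: r_def)
  have d_eq: "d n = real (Suc n) * r (Suc n)" for n
  proof -
    have "r n = real (Suc (Suc n)) * r (Suc n)"
      unfolding r_def fact_Suc[of "Suc n"] by (simp del: fact_Suc)
    then show ?thesis by (simp add: d_def algebra_simps)
  qed
  have dpos: "0 < d n" and r_le_d: "r (Suc n) \<le> d n" for n
    using rpos[of "Suc n"] by (simp_all add: d_eq)
  have r_mono: "r m \<le> r n" if "n \<le> m" for m n
    using that e unfolding r_def by (intro divide_left_mono fact_mono) auto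
  have r_lim: "r \<longlonglongrightarrow> 0"
  proof (rule tendsto_sandwich[where f = "\<lambda>_. 0" and h = "\<lambda>n. e * inverse (real (Suc n))"])
    have "r n \<le> e * inverse (real (Suc n))" for n
    proof -
      have "real (Suc n) \<le> real (fact (Suc n))"
        by (simp only: of_nat_le_iff fact_ge_self)
      then show ?thesis
        unfolding r_def divide_inverse of_nat_fact
        using e by (intro mult_left_mono le_imp_inverse_le) (simp_all del: fact_Suc)
    qed
    then show "\<forall>\<^sub>F n in sequentially. r n \<le> e * inverse (real (Suc n))"
      by (intro always_eventually allI)
    show "(\<lambda>n. e * inverse (real (Suc n))) \<longlonglongrightarrow> 0"
      by (rule tendsto_mult_right_zero[OF LIMSEQ_inverse_real_of_nat])
  qed (use rpos in \<open>auto intro!: always_eventually less_imp_le\<close>)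

  \<comment> \<open>A step of size \<open>d n\<close> is made with tolerance
    \<open>r (Suc n)\<close>, which also bounds the sum of all later steps.\<close>
  define Q where "Q n A B \<longleftrightarrow> (\<exists>x y. norm x \<le> 1 \<and> norm y \<le> 1 \<and>
      norm A - r (Suc n) \<le> norm (A x y) \<and> norm (B - A) \<le> d n \<and> norm A + d n - r (Suc n) \<le> norm B \<and>
      (\<forall>x' y'. norm x' \<le> 1 \<longrightarrow> norm y' \<le> 1 \<longrightarrow>
        norm (B x' y') \<le> norm A + d n * (norm (A x' y) / norm A) \<and>
        norm (B x' y') \<le> norm A + d n * (norm (A x y') / norm A)))"
    for n and A B :: "'a \<Rightarrow>\<^sub>L ('b \<Rightarrow>\<^sub>L 'k)"
  \<comment> \<open>The invariant keeps the operators nonzero, so that the next perturbation exists,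
    and pins the start of the chosen sequence to \<open>T\<close>.\<close>
  define P where "P n A \<longleftrightarrow> A \<in> operators_into_dual sX sY \<and> A \<noteq> 0 \<and> (n = 0 \<longrightarrow> A = T)"
    for n :: nat and A :: "'a \<Rightarrow>\<^sub>L ('b \<Rightarrow>\<^sub>L 'k)"
  have "\<exists>A. \<forall>n. P n (A n) \<and> Q n (A n) (A (Suc n))"
  proof (rule dependent_nat_choice)
    show "\<exists>A. P 0 A" using T T0 by (auto simp: P_def)
    fix A n assume "P n A"
    then have A: "A \<in> operators_into_dual sX sY" "A \<noteq> 0" by (simp_all add: P_def)
    from rank_one_perturbation[OF A dpos[of n] rpos[of "Suc n"]]
    obtain B where B: "B \<in> operators_into_dual sX sY" "Q n A B"
      unfolding Q_def by blast
    then have "norm A + d n - r (Suc n) \<le> norm B" by (auto simp: Q_def)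
    \<comment> \<open>Norms never decrease along the iteration: the gain \<open>d n\<close> is at
      least the tolerance \<open>r (Suc n)\<close>.\<close>
    then have "B \<noteq> 0" using r_le_d[of n] A(2) zero_less_norm_iff[of A] by fastforce
    with B show "\<exists>B. P (Suc n) B \<and> Q n A B" by (auto simp: P_def)
  qed
  then obtain A where P: "\<And>n. P n (A n)" and Q: "\<And>n. Q n (A n) (A (Suc n))" by blast
  have A_op: "A n \<in> operators_into_dual sX sY" and A0: "0 < norm (A n)" for n
    using P[of n] by (simp_all add: P_def)
  have "A 0 = T" using P[of 0] by (simp add: P_def)
  obtain x y where x: "\<And>n. norm (x n) \<le> 1" and y: "\<And>n. norm (y n) \<le> 1"
    and attain: "\<And>n. norm (A n) - r (Suc n) \<le> norm (A n (x n) (y n))"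
    and step: "\<And>n. norm (A (Suc n) - A n) \<le> d n"
    and grow: "\<And>n. norm (A n) + d n - r (Suc n) \<le> norm (A (Suc n))"
    and le1: "\<And>n x' y'. norm x' \<le> 1 \<Longrightarrow> norm y' \<le> 1 \<Longrightarrow>
        norm (A (Suc n) x' y') \<le> norm (A n) + d n * (norm (A n x' (y n)) / norm (A n))"
    and le2: "\<And>n x' y'. norm x' \<le> 1 \<Longrightarrow> norm y' \<le> 1 \<Longrightarrow>
        norm (A (Suc n) x' y') \<le> norm (A n) + d n * (norm (A n (x n) y') / norm (A n))"
    using Q unfolding Q_def by metis

  have dist: "norm (A m - A n) \<le> r n" if "n \<le> m" for m n
  proof -
    \<comment> \<open>The sharper bound \<open>r n - r m\<close> is the one that telescopes, since
      \<open>d k = r k - r (Suc k)\<close>.\<close>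
    from that have "norm (A m - A n) \<le> r n - r m"
    proof (induction rule: dec_induct)
      case (step k)
      have "norm (A (Suc k) - A n) \<le> norm (A (Suc k) - A k) + norm (A k - A n)"
        using norm_triangle_ineq[of "A (Suc k) - A k" "A k - A n"] by simp
      with step.IH \<open>\<And>n. norm (A (Suc n) - A n) \<le> d n\<close>[of k] show ?case
        by (simp add: d_def)
    qed simp
    with rpos[of m] show ?thesis by simp
  qed
  have "Cauchy A"
    unfolding Cauchy_altdef2 dist_norm
  proof (intro allI impI)
    fix c :: real assume "0 < c"
    then obtain N where "r N < c"
      using order_tendstoD(2)[OF r_lim] eventually_happens' sequentially_bot by blast
    then show "\<exists>N. \<forall>n\<ge>N. norm (A n - A N) < c"
      using dist by (meson le_less_trans)
  qed
  then obtain S where S: "A \<longlonglongrightarrow> S"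
    by (meson Cauchy_convergent convergent_def)
  have S_dist: "norm (S - A n) \<le> r n" for n
    using dist by (intro LIMSEQ_le_const2[OF tendsto_norm[OF tendsto_diff[OF S tendsto_const]]]) blast
  have S_op: "S \<in> operators_into_dual sX sY"
    using closed_operators_into_dual A_op S by (rule closed_sequentially)

  have eval: "\<bar>norm (B u v) - norm (C u v)\<bar> \<le> norm (B - C)"
    if "norm u \<le> 1" "norm v \<le> 1" for B C :: "'a \<Rightarrow>\<^sub>L ('b \<Rightarrow>\<^sub>L 'k)" and u v
    using norm_blinfun2_ball[OF that, of "B - C"] norm_triangle_ineq3[of "B u v" "C u v"]
    by (simp add: blinfun.diff_left)
  \<comment> \<open>The term \<open>2 * r n\<close> pays for replacing \<open>S\<close> by
    \<open>A n\<close> in both the norm and the value; the rest is the relative defect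
    \<open>4 / Suc n\<close>, with \<open>norm (A n)\<close> bounded by
    \<open>norm S + e\<close>.\<close>
  define \<eta> where "\<eta> n = 2 * r n + (norm S + e) * (4 / real (Suc n))" for n
  have "\<eta> \<longlonglongrightarrow> 2 * 0 + (norm S + e) * (4 * 0)"
    unfolding \<eta>_def divide_inverse
    by (intro tendsto_intros r_lim LIMSEQ_inverse_real_of_nat)
  then have \<eta>: "\<eta> \<longlonglongrightarrow> 0" by simp
  \<comment> \<open>One estimate serves both operators: \<open>(u, v)\<close> will be
    \<open>(x m, y n)\<close> via \<open>le1\<close> for \<open>S\<close>, and
    \<open>(x n, y m)\<close> via \<open>le2\<close> for its transposition.\<close>
  have core: "norm S - \<eta> n \<le> norm (S u v)"
    if "n < m" and uv: "norm u \<le> 1" "norm v \<le> 1"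
      and le: "norm (A (Suc n) (x m) (y m)) \<le> norm (A n) + d n * (norm (A n u v) / norm (A n))"
    for n m u v
  proof -
    define q where "q = norm (A n u v) / norm (A n)"
    \<comment> \<open>Passing from \<open>A m\<close> back to \<open>A (Suc n)\<close> costs
      \<open>r (Suc n)\<close> twice, once in the norm and once in the value; \<open>n < m\<close>
      gives \<open>Suc n \<le> m\<close>.\<close>
    have "norm (A (Suc n)) - 2 * r (Suc n) - r (Suc m) \<le> norm (A (Suc n) (x m) (y m))"
      using attain[of m] dist[of "Suc n" m] eval[OF x y, of "A m" m m "A (Suc n)"]
        norm_triangle_ineq3[of "A m" "A (Suc n)"] that(1)
      by simp
    with grow[of n] le r_mono[of "Suc n" "Suc m"] that(1)
    have "d n * (1 - q) \<le> 4 * r (Suc n)"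
      unfolding q_def[symmetric] by (simp add: algebra_simps)
    \<comment> \<open>The factorial decay enters here: four errors of size at most
      \<open>r (Suc n)\<close> are weighed against \<open>d n\<close>, which is \<open>Suc n\<close>
      times as large.\<close>
    then have "r (Suc n) * (real (Suc n) * (1 - q)) \<le> r (Suc n) * 4"
      unfolding d_eq by (simp add: mult_ac)
    then have "real (Suc n) * (1 - q) \<le> 4"
      using rpos[of "Suc n"] by simp
    then have q: "1 - q \<le> 4 / real (Suc n)"
      by (simp add: field_simps)
    have "norm (A n) - norm (A n u v) = norm (A n) * (1 - q)"
      using A0[of n] by (simp add: q_def field_simps)
    also have "\<dots> \<le> norm (A n) * (4 / real (Suc n))"
      using q by (rule mult_left_mono) simp
    also have "\<dots> \<le> (norm S + e) * (4 / real (Suc n))"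
    proof (rule mult_right_mono)
      have "norm (A n) \<le> norm S + norm (S - A n)"
        using norm_triangle_sub[of "A n" S] by (simp add: norm_minus_commute)
      with S_dist[of n] r_mono[of 0 n] show "norm (A n) \<le> norm S + e"
        by (simp add: r_def)
    qed simp
    finally show ?thesis
      using S_dist[of n] eval[OF uv, of S "A n"] norm_triangle_ineq3[of S "A n"]
      by (simp add: \<eta>_def)
  qed
  have "S \<in> wstar_QNA sX sY"
  proof (rule wstar_QNA_if_double_sequence[OF S_op x y _ \<eta>])
    show "norm S - \<eta> n \<le> norm (S (x m) (y n))" if "n < m" for n m
      by (rule core[OF that x y le1[OF x y]])
  qed
  moreover have "transposition S \<in> wstar_QNA sY sX"
  proof (rule wstar_QNA_if_double_sequence[OF transposition_in_operators[OF S_op] y x _ \<eta>])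
    show "norm (transposition S) - \<eta> n \<le> norm (transposition S (y m) (x n))" if "n < m" for n m
      using core[OF that x y le2[OF x y]] by simp
  qed
  moreover have "norm (S - T) \<le> e"
    using S_dist[of 0] by (simp add: \<open>A 0 = T\<close> r_def)
  ultimately show ?thesis using S_op by blast
qed

section \<open>Density\<close>

lemma zero_wstar_QNA:
  "(0 :: 'a::banach \<Rightarrow>\<^sub>L ('b::banach \<Rightarrow>\<^sub>L 'k::{real_normed_field,heine_borel})) \<in> wstar_QNA sX sY"
  by (rule wstar_QNA_if_double_sequence[where x = "\<lambda>_. 0" and y = "\<lambda>_. 0" and \<eta> = "\<lambda>_. 0"])
    (simp_all add: operators_into_dual_def dual_space_def)

text \<open>Phrased for a general complete scalar type with the Heine-Borel property, so that the
  real and complex cases are both instances.\<close>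

lemma operators_into_dual_subset_closure:
  fixes sX :: "'k::{real_normed_field,banach,heine_borel} \<Rightarrow> 'a::banach \<Rightarrow> 'a"
    and sY :: "'k \<Rightarrow> 'b::banach \<Rightarrow> 'b"
  shows "operators_into_dual sX sY \<subseteq>
    closure {T \<in> operators_into_dual sX sY.
      T \<in> wstar_QNA sX sY \<and> transposition T \<in> wstar_QNA sY sX}"
proof
  fix T assume T: "T \<in> operators_into_dual sX sY"
  show "T \<in> closure {T \<in> operators_into_dual sX sY.
      T \<in> wstar_QNA sX sY \<and> transposition T \<in> wstar_QNA sY sX}"
    unfolding closure_approachable
  proof (intro allI impI)
    fix e :: real assume "0 < e"
    then have "0 < e / 2" by simp
    have "\<exists>S \<in> operators_into_dual sX sY. norm (S - T) \<le> e / 2 \<and>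
        S \<in> wstar_QNA sX sY \<and> transposition S \<in> wstar_QNA sY sX"
    \<comment> \<open>The perturbation divides by \<open>norm T\<close>, so the operator 0 is
      treated apart; it approximates itself.\<close>
    proof (cases "T = 0")
      case True
      have "transposition (0 :: 'a \<Rightarrow>\<^sub>L ('b \<Rightarrow>\<^sub>L 'k)) = 0"
        by (intro blinfun_eqI) simp
      with True T \<open>0 < e / 2\<close> show ?thesis
        by (intro bexI[of _ T]) (simp_all add: zero_wstar_QNA)
    next
      case False
      with T \<open>0 < e / 2\<close> show ?thesis by (intro norm_attaining_approximation)
    qed
    with \<open>0 < e\<close> show "\<exists>S\<in>{T \<in> operators_into_dual sX sY.
        T \<in> wstar_QNA sX sY \<and> transposition T \<in> wstar_QNA sY sX}. dist S T < e"
      by (force simp: dist_norm)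
  qed
qed

theorem theorem2p4:
  shows
    "(\<forall>(sX :: real \<Rightarrow> 'x::banach \<Rightarrow> 'x) (sY :: real \<Rightarrow> 'y::banach \<Rightarrow> 'y).
        banach_over sX \<longrightarrow> banach_over sY \<longrightarrow>
        operators_into_dual sX sY \<subseteq>
          closure {T \<in> operators_into_dual sX sY.
            T \<in> wstar_QNA sX sY \<and> transposition T \<in> wstar_QNA sY sX})
     \<and>
     (\<forall>(sX :: complex \<Rightarrow> 'x \<Rightarrow> 'x) (sY :: complex \<Rightarrow> 'y \<Rightarrow> 'y).
        banach_over sX \<longrightarrow> banach_over sY \<longrightarrow>
        operators_into_dual sX sY \<subseteq>
          closure {T \<in> operators_into_dual sX sY.
            T \<in> wstar_QNA sX sY \<and> transposition T \<in> wstar_QNA sY sX})"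
  by (intro conjI allI impI operators_into_dual_subset_closure)

end
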